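(* Let $m\ge 1$, $n=2m$, let $p$ be an odd prime and $q=p^n$. Let $t$ be a positive integer with $t\equiv 2\pmod 4$ and $t\not\equiv 0\pmod{p^m+1}$. Set $s_1=\frac{t+2}{4}$, $s_2=\frac{3t+2}{4}$, $d_1=s_1(p^m-1)+1$, $d_2=s_2(p^m-1)+1$ and $l=\gcd(t,p^m+1)$. For $a,b\in\mathbb{F}_q$ put $$T_2(a,b)=\sum_{x\in\mathbb{F}_q}\zeta_p^{\mathrm{Tr}_n(ax^{d_1}+bx^{d_2})}.$$ Then, as $(a,b)$ ranges over $\mathbb{F}_q\times\mathbb{F}_q$, the value distribution of $T_2(a,b)$ is as follows: \begin{itemize} \item the value $p^{2m}$ occurs $1$ time; \item the value $(\frac{3l}{2}-1)p^m$ occurs $\frac{2(p^{2m}-1)(l-p^m-1)(l-2p^m-2)}{3l^3}$ times; \item the value $(l-1)p^m$ occurs $\frac{(p^{2m}-1)(2p^m+2-(p^m+3)l)(l-2p^m-2)}{l^3}$ times; \item the value $(\frac{l}{2}-1)p^m$ occurs $\frac{2(p^{2m}-1)\left((p^{2m}+2p^m+3)l^2-(2p^{2m}+7p^m+5)l+2(p^m+1)^2\right)}{l^3}$ times; \item the value $-p^m$ occurs $\frac{(p^{2m}-1)\left(3(p^{2m}+1)l^3-(6p^{2m}+9p^m+11)l^2+6(p^{2m}+3p^m+2)l-4(p^m+1)^2\right)}{3l^3}$ times. \end{itemize}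
   Context: $\mathrm{Tr}_n$ denotes the absolute trace map from $\mathbb{F}_{q}$ to $\mathbb{F}_p$, and $\zeta_p$ is a primitive complex $p$-th root of unity. The value distribution of $T_2(a,b)$ is the list of values taken together with the number of pairs $(a,b)\in\mathbb{F}_q\times\mathbb{F}_q$ at which each is taken. *)

theory Defs
  imports Complex_Main "HOL-Library.Cardinality" "HOL-Computational_Algebra.Primes"
begin

definition primitive_root_unity :: "nat \<Rightarrow> complex \<Rightarrow> bool" where
  "primitive_root_unity k z \<longleftrightarrow> k > 0 \<and> z ^ k = 1 \<and> (\<forall>j. 0 < j \<and> j < k \<longrightarrow> z ^ j \<noteq> 1)"

(* Absolute trace of a finite field of order CHAR('a) ^ n. Its values lie in the prime subfield,
   which is kept as the subset {of_nat k | k < CHAR('a)} of the field itself. *)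
definition abs_trace :: "nat \<Rightarrow> 'a::finite_field \<Rightarrow> 'a" where
  "abs_trace n x = (\<Sum>i<n. x ^ (CHAR('a) ^ i))"

(* Least nonnegative integer representing an element of the prime subfield;
   unspecified on all other elements. *)
definition prime_field_rep :: "'a::finite_field \<Rightarrow> nat" where
  "prime_field_rep y = (THE k. k < CHAR('a) \<and> of_nat k = y)"

(* The sum of z^Tr(a x^d1 + b x^d2) over the field of order CHAR('a) ^ n;
   z is meant to be a primitive CHAR('a)-th root of unity. *)
definition exp_sum :: "complex \<Rightarrow> nat \<Rightarrow> nat \<Rightarrow> nat \<Rightarrow> 'a::finite_field \<Rightarrow> 'a \<Rightarrow> complex" where
  "exp_sum z n d1 d2 a b =
     (\<Sum>x\<in>UNIV. z ^ prime_field_rep (abs_trace n (a * x ^ d1 + b * x ^ d2)))"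

end

theory Submission
  imports Defs "HOL-Computational_Algebra.Polynomial" "HOL-Library.FuncSet" "HOL-Number_Theory.Residues"
begin

text \<open>
  Write \<open>P = p ^ m\<close>, \<open>k = t / 2\<close>, which is odd, and let \<open>U\<close> be the group of the \<open>(P + 1)\<close>-th roots of
  unity. The exponents are \<open>\<equiv> 1\<close> modulo \<open>P - 1\<close>, so \<open>F x = a x\<^sup>d\<^sup>1 + b x\<^sup>d\<^sup>2\<close> is homogeneous of degree one
  over the subfield of order \<open>P\<close>; averaging over that subfield turns the exponential sum into
  \<open>(N - 1) P\<close>, where \<open>N\<close> counts the \<open>z = x ^ (P - 1)\<close> in \<open>U\<close> for which \<open>F x\<close> has relative trace 0.
  With \<open>w = z ^ k\<close> this condition is the self-reciprocal cubic equation
  \<open>b w\<^sup>3 + a w\<^sup>2 + conj a w + conj b = 0\<close>. The map \<open>z \<mapsto> z ^ k\<close> on \<open>U\<close> is \<open>l / 2\<close> to 1, so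
  \<open>N = r l / 2\<close> with \<open>r \<le> 3\<close> roots \<open>w\<close> unless \<open>a = b = 0\<close>.

  A value of such a cubic at a point of \<open>U\<close> lies on a line over the small field, and four values
  determine the cubic. As there are \<open>P ^ 4\<close> cubics, evaluation at four points is a bijection onto
  the product of the lines, whence \<open>j \<le> 4\<close> given points are roots of exactly \<open>P ^ (4 - j)\<close> cubics.
  This yields the binomial moments of \<open>r\<close> up to order 3, which determine its distribution.
\<close>

hide_const (open) UnivPoly.up_ring.monom UnivPoly.up_ring.coeff

section \<open>Power maps on a finite field\<close>

lemma card_power_eq_le:
  fixes c :: "'a::{idom,finite}"
  assumes "n > 0"
  shows "card {x. x ^ n = c} \<le> n"
proof -
  let ?p = "monom 1 n - [:c:]"
  have "coeff ?p n = 1"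
    using assms by (simp add: coeff_pCons split: nat.splits)
  then have "?p \<noteq> 0"
    by (metis coeff_0 zero_neq_one)
  have "{x. x ^ n = c} = {x. poly ?p x = 0}"
    by (simp add: poly_monom)
  also have "card \<dots> \<le> degree ?p"
    by (rule card_poly_roots_bound) fact
  also have "\<dots> \<le> n"
    by (intro degree_diff_le degree_monom_le) simp
  finally show ?thesis .
qed

lemma card_preimage_const:
  assumes "finite A" "finite B" "\<And>y. y \<in> B \<Longrightarrow> card {x\<in>A. f x = y} = c"
  shows "card {x\<in>A. f x \<in> B} = c * card B"
proof -
  have "{x\<in>A. f x \<in> B} = (\<Union>y\<in>B. {x\<in>A. f x = y})"
    by auto
  also have "card \<dots> = (\<Sum>y\<in>B. card {x\<in>A. f x = y})"
    using assms by (intro card_UN_disjoint) auto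
  also have "\<dots> = c * card B"
    using assms by simp
  finally show ?thesis .
qed

context
  fixes N K :: nat
  assumes NK: "CARD('a::finite_field) - 1 = N * K"
begin

lemma cofactors_pos: "N > 0" "K > 0"
proof -
  have "card {0::'a, 1} \<le> CARD('a)"
    by (rule card_mono) auto
  with NK show "N > 0" "K > 0"
    by (auto intro!: gr0I)
qed

lemma power_cofactor:
  fixes x :: 'a
  assumes "x \<noteq> 0"
  shows "x ^ (N * K) = 1"
proof -
  have "x * x ^ (N * K) = x ^ Suc (CARD('a) - 1)"
    by (simp only: NK power_Suc)
  also have "\<dots> = x"
    using finite_field_power_card_eq_same[of x] finite_UNIV_card_ge_0[where ?'a = 'a] by simp
  finally show ?thesis
    using assms by simp
qed

text \<open>Every fibre of \<open>x \<mapsto> x ^ K\<close> has at most \<open>K\<close> elements and there are at most \<open>N\<close> of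
  them, but together they hold all \<open>N * K\<close> units; so both bounds are attained.\<close>

lemma card_roots_of_unity_and_fibre:
  shows "card {u::'a. u ^ N = 1} = N"
    and "u ^ N = 1 \<Longrightarrow> card {x::'a. x ^ K = u} = K"
proof -
  let ?R = "{u::'a. u ^ N = 1}" and ?f = "\<lambda>u. card {x::'a. x ^ K = u}"
  note pos = cofactors_pos
  have "x \<noteq> 0 \<longleftrightarrow> (x ^ K) ^ N = 1" for x :: 'a
    using power_cofactor[of x] pos
    by (cases "x = 0") (simp_all add: power_0_left mult.commute flip: power_mult)
  then have "UNIV - {0} = (\<Union>u\<in>?R. {x::'a. x ^ K = u})"
    by auto
  then have "card (UNIV - {0::'a}) = card (\<Union>u\<in>?R. {x::'a. x ^ K = u})"
    by simp
  also have "\<dots> = (\<Sum>u\<in>?R. ?f u)"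
    by (rule card_UN_disjoint) auto
  finally have total: "(\<Sum>u\<in>?R. ?f u) = N * K"
    using NK by (simp add: card_Diff_singleton)
  have le: "?f u \<le> K" for u
    using card_power_eq_le pos by blast
  have R_le: "card ?R \<le> N"
    using card_power_eq_le pos by blast
  have "N * K \<le> card ?R * K"
    using sum_mono[of ?R ?f "\<lambda>_. K"] le total by simp
  with R_le pos show R: "card ?R = N"
    by simp
  show "?f u = K" if "u ^ N = 1"
  proof (rule ccontr)
    assume "?f u \<noteq> K"
    with le[of u] have "?f u < K"
      by simp
    then have "(\<Sum>u\<in>?R. ?f u) < (\<Sum>u\<in>?R. K)"
      using le that by (intro sum_strict_mono_ex1) auto
    with total R show False
      by simp
  qed
qed

end

section \<open>The prime subfield and the absolute trace\<close>

lemma prime_field_eq_range: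
  fixes y :: "'a::finite_field"
  assumes "y ^ CHAR('a) = y"
  obtains k where "k < CHAR('a)" "y = of_nat k"
proof -
  let ?p = "CHAR('a)"
  have p: "?p > 1"
    using prime_gt_1_nat[OF CHAR_prime] .
  have inj: "inj_on (of_nat :: nat \<Rightarrow> 'a) {..<?p}"
    by (auto simp: inj_on_def of_nat_eq_iff_cong_CHAR cong_less_modulus_unique_nat)
  have fermat: "of_nat k ^ ?p = (of_nat k :: 'a)" for k
    using p by (induction k) (simp_all add: freshmans_dream add.commute)
  \<comment> \<open>\<open>x ^ ?p - x\<close> has at most \<open>?p\<close> roots, and the elements
    \<open>of_nat k\<close> with \<open>k < ?p\<close> already supply that many.\<close>
  let ?q = "monom 1 ?p - [:0, 1:] :: 'a poly"
  have "coeff ?q ?p = 1"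
    using p by (simp add: coeff_pCons split: nat.splits)
  then have "?q \<noteq> 0"
    by (metis coeff_0 zero_neq_one)
  then have "card {x. poly ?q x = 0} \<le> degree ?q"
    by (rule card_poly_roots_bound)
  also have "degree ?q \<le> ?p"
    using p by (intro degree_diff_le degree_monom_le) simp
  finally have "card {x::'a. x ^ ?p = x} \<le> ?p"
    by (simp add: poly_monom)
  moreover have "of_nat ` {..<?p} \<subseteq> {x::'a. x ^ ?p = x}"
    using fermat by auto
  ultimately have "of_nat ` {..<?p} = {x::'a. x ^ ?p = x}"
    using inj by (intro card_seteq) (auto simp: card_image)
  with assms that show thesis
    by (metis (mono_tags, lifting) image_iff lessThan_iff mem_Collect_eq)
qed

lemma prime_field_rep_of_nat:
  "prime_field_rep (of_nat k :: 'a::finite_field) = k mod CHAR('a)"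
  unfolding prime_field_rep_def of_nat_eq_iff_cong_CHAR
  by (rule the_equality) (auto simp: cong_def)

text \<open>Exponents of \<open>z\<close> matter only modulo the characteristic, so any natural
  representative may replace the least one.\<close>

lemma power_prime_field_rep_of_nat:
  fixes z :: complex
  assumes "z ^ CHAR('a::finite_field) = 1"
  shows "z ^ prime_field_rep (of_nat k :: 'a) = z ^ k"
proof -
  have "z ^ k = z ^ (CHAR('a) * (k div CHAR('a)) + k mod CHAR('a))"
    by simp
  also have "\<dots> = z ^ (k mod CHAR('a))"
    unfolding power_add power_mult using assms by simp
  finally show ?thesis
    by (simp add: prime_field_rep_of_nat)
qed

lemma abs_trace_add:
  "abs_trace n (x + y) = abs_trace n x + abs_trace n (y :: 'a::finite_field)"
  by (simp add: abs_trace_def freshmans_dream' sum.distrib)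

lemma abs_trace_0 [simp]: "n > 0 \<Longrightarrow> abs_trace n (0 :: 'a::finite_field) = 0"
  by (simp add: abs_trace_def power_0_left)

text \<open>The trace is a nonzero polynomial of degree at most \<open>CHAR('a) ^ (n - 1)\<close>.
  The bound later provides elements of nonzero trace.\<close>

lemma card_abs_trace_eq_0_le:
  assumes "n > 0"
  shows "card {x :: 'a::finite_field. abs_trace n x = 0} \<le> CHAR('a) ^ (n - 1)"
proof -
  have p: "CHAR('a) > 1"
    using prime_gt_1_nat[OF CHAR_prime] .
  let ?q = "\<Sum>i<n. monom 1 (CHAR('a) ^ i) :: 'a poly"
  \<comment> \<open>Only \<open>i = 0\<close> reaches the linear term, because
    \<open>CHAR('a) ^ i > 1\<close> for \<open>i > 0\<close>.\<close>
  have "coeff ?q 1 = (\<Sum>i<n. if i = 0 then 1 else 0)"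
    unfolding coeff_sum using p by (intro sum.cong) auto
  also have "\<dots> = 1"
    using assms by simp
  finally have "?q \<noteq> 0"
    by auto
  have "{x :: 'a. abs_trace n x = 0} = {x. poly ?q x = 0}"
    by (simp add: abs_trace_def poly_sum poly_monom)
  also have "card \<dots> \<le> degree ?q"
    by (rule card_poly_roots_bound) fact
  also have "\<dots> \<le> CHAR('a) ^ (n - 1)"
    using p by (intro degree_sum_le order_trans[OF degree_monom_le] power_increasing) auto
  finally show ?thesis .
qed

section \<open>Conjugation, the unit circle and self-reciprocal cubics\<close>

locale quadratic_extension =
  fixes m P :: nat and conj :: "'a::finite_field \<Rightarrow> 'a"
  assumes m_pos: "m > 0"
    and P_eq: "P = CHAR('a) ^ m"
    and card_UNIV_eq: "CARD('a) = P ^ 2"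
    and conj_eq: "conj x = x ^ P"
begin

lemma P_gt_1: "P > 1"
  using prime_gt_1_nat[OF CHAR_prime[where 'a = 'a]] m_pos
  by (simp add: P_eq one_less_power del: One_nat_def)

lemma conj_conj [simp]: "conj (conj x) = x"
  using finite_field_power_card_eq_same[of x]
  by (simp add: conj_eq card_UNIV_eq power2_eq_square power_mult)

lemma conj_add: "conj (x + y) = conj x + conj y"
  by (simp add: conj_eq P_eq freshmans_dream')

lemma conj_mult: "conj (x * y) = conj x * conj y"
  by (simp add: conj_eq power_mult_distrib)

lemma conj_power: "conj (x ^ k) = conj x ^ k"
  by (simp add: conj_eq mult.commute flip: power_mult)

lemma conj_0 [simp]: "conj 0 = 0"
  using P_gt_1 by (simp add: conj_eq power_0_left)

lemma conj_minus: "conj (x - y) = conj x - conj y"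
  using conj_add[of "x - y" y] by simp

lemma CARD_minus_1: "CARD('a) - 1 = (P + 1) * (P - 1)"
  by (simp add: card_UNIV_eq power2_eq_square algebra_simps)

text \<open>Since \<open>conj\<close> is the involution fixing the subfield of order
  \<open>P\<close>, this is the kernel of the relative norm, on which \<open>conj\<close> is
  inversion.\<close>

definition unit_circle :: "'a set" where
  "unit_circle = {z. conj z * z = 1}"

lemma unit_circle_eq: "unit_circle = {z. z ^ (P + 1) = 1}"
  by (simp add: unit_circle_def conj_eq mult.commute)

lemma card_unit_circle: "card unit_circle = P + 1"
  unfolding unit_circle_eq by (rule card_roots_of_unity_and_fibre[OF CARD_minus_1])

lemma unit_circle_power: "z \<in> unit_circle \<Longrightarrow> z ^ k \<in> unit_circle"
  by (simp add: unit_circle_def conj_power flip: power_mult_distrib)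

definition cubic :: "'a \<Rightarrow> 'a \<Rightarrow> 'a \<Rightarrow> 'a" where
  "cubic a b w = b * w ^ 3 + a * w ^ 2 + conj a * w + conj b"

lemma cubic_minus: "cubic (a - a') (b - b') w = cubic a b w - cubic a' b' w"
  by (simp add: cubic_def conj_minus algebra_simps)

text \<open>The values of self-reciprocal cubics at a point \<open>w\<close> of the unit circle satisfy
  \<open>w\<^sup>3 conj e = e\<close>, which cuts out a line over the subfield of order \<open>P\<close>.\<close>

definition line :: "'a \<Rightarrow> 'a set" where
  "line w = {e. w ^ 3 * conj e = e}"

lemma zero_in_line [simp]: "0 \<in> line w"
  by (simp add: line_def)

text \<open>On the unit circle \<open>conj w\<close> is the inverse of \<open>w\<close>, so
  conjugating and multiplying by \<open>w ^ 3\<close> reverses the coefficients and conjugates them,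
  which gives the same cubic back.\<close>

lemma cubic_in_line:
  assumes "w \<in> unit_circle"
  shows "cubic a b w \<in> line w"
proof -
  have w: "w * conj w = 1"
    using assms by (simp add: unit_circle_def mult.commute)
  have "w ^ 3 * conj (cubic a b w)
      = conj b * (w * conj w) ^ 3 + conj a * w * (w * conj w) ^ 2 + a * w ^ 2 * (w * conj w) + b * w ^ 3"
    by (simp add: cubic_def conj_add conj_mult conj_power power_mult_distrib algebra_simps
        power2_eq_square power3_eq_cube)
  then show ?thesis
    by (simp add: line_def cubic_def w algebra_simps)
qed

text \<open>The line is the root set of a polynomial of degree \<open>P\<close>. That points of the
  unit circle attain the bound comes later, from counting.\<close>

lemma card_line_le:
  assumes "w \<noteq> 0"
  shows "card (line w) \<le> P"
proof -
  let ?p = "monom (w ^ 3) P - [:0, 1:]"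
  have "coeff ?p P = w ^ 3"
    using P_gt_1 by (simp add: coeff_pCons split: nat.splits)
  then have "?p \<noteq> 0"
    using assms by (metis coeff_0 power_not_zero)
  have "line w = {x. poly ?p x = 0}"
    by (simp add: poly_monom line_def conj_eq)
  also have "card \<dots> \<le> degree ?p"
    by (rule card_poly_roots_bound) fact
  also have "\<dots> \<le> P"
    using P_gt_1 by (intro degree_diff_le degree_monom_le) simp
  finally show ?thesis .
qed

lemma card_cubic_roots_le:
  assumes "(a, b) \<noteq> (0, 0)"
  shows "card {w. cubic a b w = 0} \<le> 3"
proof -
  let ?p = "[:conj b, conj a, a, b:]"
  have "?p \<noteq> 0"
    using assms by auto
  have "{w. cubic a b w = 0} = {w. poly ?p w = 0}"
    by (simp add: cubic_def algebra_simps power2_eq_square power3_eq_cube)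
  also have "card \<dots> \<le> degree ?p"
    by (rule card_poly_roots_bound) fact
  also have "\<dots> \<le> 3"
    by (simp add: degree_pCons_eq_if)
  finally show ?thesis .
qed

text \<open>The difference of two such cubics has the same shape, and four roots are too many unless
  it vanishes.\<close>

lemma inj_cubic_values:
  assumes "card W = 4"
  shows "inj (\<lambda>(a, b). \<lambda>w\<in>W. cubic a b w)"
proof (rule injI, clarify)
  fix a b a' b'
  assume eq: "(\<lambda>w\<in>W. cubic a b w) = (\<lambda>w\<in>W. cubic a' b' w)"
  have "cubic (a - a') (b - b') w = 0" if "w \<in> W" for w
    using fun_cong[OF eq, of w] that by (simp add: cubic_minus)
  then have "card W \<le> card {w. cubic (a - a') (b - b') w = 0}"
    by (intro card_mono) auto
  with card_cubic_roots_le[of "a - a'" "b - b'"] assms show "a = a' \<and> b = b'"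
    by force
qed

text \<open>Four values determine the cubic, and \<open>P ^ 4\<close> cubics inject into a product of four lines with
  at most \<open>P\<close> points each; hence all four lines have \<open>P\<close> points and the evaluation is onto.\<close>

lemma bij_cubic_values:
  assumes W: "W \<subseteq> unit_circle" "card W = 4"
  shows "bij_betw (\<lambda>(a, b). \<lambda>w\<in>W. cubic a b w) UNIV (PiE W line)"
    and "w \<in> W \<Longrightarrow> card (line w) = P"
proof -
  let ?ev = "\<lambda>(a, b). \<lambda>w\<in>W. cubic a b w"
  have fin: "finite (PiE W line)"
    by (intro finite_PiE) auto
  have sub: "range ?ev \<subseteq> PiE W line"
    using W cubic_in_line by (auto simp: PiE_def Pi_def)
  have card_range: "card (range ?ev) = P ^ 4"
    using inj_cubic_values[OF W(2)]
    by (simp add: card_image card_UNIV_eq card_cartesian_product flip: UNIV_Times_UNIV power_add)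
  have le: "card (line w) \<le> P" if "w \<in> W" for w
    using that W P_gt_1 by (intro card_line_le) (auto simp: unit_circle_def)
  have card_PiE_line: "card (PiE W line) = (\<Prod>w\<in>W. card (line w))"
    by (simp add: card_PiE)
  also have "\<dots> \<le> (\<Prod>w\<in>W. P)"
    using le by (intro prod_mono) auto
  also have "\<dots> = P ^ 4"
    using W by simp
  finally have "range ?ev = PiE W line"
    using card_range sub fin by (intro card_seteq) auto
  then show "bij_betw ?ev UNIV (PiE W line)"
    using inj_cubic_values[OF W(2)] by (simp add: bij_betw_def)
  show "card (line w) = P" if "w \<in> W"
  proof (rule ccontr)
    assume "card (line w) \<noteq> P"
    with le[OF that] have lt: "card (line w) < P"
      by simp
    then have "(\<Prod>w\<in>W. card (line w)) < (\<Prod>w\<in>W. P)"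
      using le P_gt_1 that by (intro prod_mono_strict) auto
    with card_PiE_line card_range \<open>range ?ev = PiE W line\<close> W show False
      by simp
  qed
qed

end

section \<open>Counting cubics with prescribed roots on the unit circle\<close>

locale odd_quadratic_extension = quadratic_extension +
  assumes odd_char: "odd CHAR('a)"
begin

lemma odd_P: "odd P"
  using odd_char by (simp add: P_eq)

lemma P_ge_3: "P \<ge> 3"
  using odd_P P_gt_1 by presburger

text \<open>Odd characteristic gives \<open>P \<ge> 3\<close>, so the unit circle has room for four
  points.\<close>

lemma extend_to_four_points:
  assumes "S \<subseteq> unit_circle" "card S \<le> 4"
  obtains W where "S \<subseteq> W" "W \<subseteq> unit_circle" "card W = 4"
  using assms P_ge_3 card_unit_circle exists_subset_between[of S 4 unit_circle] by auto

lemma card_line: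
  assumes "w \<in> unit_circle"
  shows "card (line w) = P"
proof -
  obtain W where "{w} \<subseteq> W" "W \<subseteq> unit_circle" "card W = 4"
    using extend_to_four_points[of "{w}"] assms by auto
  then show ?thesis
    using bij_cubic_values(2) by blast
qed

text \<open>Extend \<open>S\<close> to four points \<open>W\<close>. Under the evaluation bijection,
  vanishing on \<open>S\<close> fixes the coordinates in \<open>S\<close> to 0 and leaves each of
  the others free on a line of \<open>P\<close> points.\<close>

lemma card_cubics_vanishing:
  assumes S: "S \<subseteq> unit_circle" "card S \<le> 4"
  shows "card {(a, b). \<forall>w\<in>S. cubic a b w = 0} = P ^ (4 - card S)"
proof -
  obtain W where W: "S \<subseteq> W" "W \<subseteq> unit_circle" "card W = 4"
    using extend_to_four_points[OF S] .
  let ?ev = "\<lambda>(a, b). \<lambda>w\<in>W. cubic a b w"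
  let ?L = "\<lambda>w. if w \<in> S then {0} else line w"
  note bij = bij_cubic_values(1)[OF W(2,3)]
  have "?ev ` {(a, b). \<forall>w\<in>S. cubic a b w = 0} = PiE W ?L"
  proof (intro equalityI subsetI)
    fix f assume "f \<in> ?ev ` {(a, b). \<forall>w\<in>S. cubic a b w = 0}"
    then show "f \<in> PiE W ?L"
      using W cubic_in_line by auto
  next
    fix f assume f: "f \<in> PiE W ?L"
    then have "f \<in> PiE W line"
      by (auto simp: PiE_def Pi_def split: if_splits)
    then obtain a b where ab: "f = ?ev (a, b)"
      using bij by (fastforce simp: bij_betw_def)
    have "cubic a b w = 0" if "w \<in> S" for w
      using f that W(1) unfolding ab by (auto simp: PiE_def Pi_def split: if_splits)
    with ab show "f \<in> ?ev ` {(a, b). \<forall>w\<in>S. cubic a b w = 0}"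
      by blast
  qed
  moreover have "inj_on ?ev {(a, b). \<forall>w\<in>S. cubic a b w = 0}"
    using bij by (auto simp: bij_betw_def intro: inj_on_subset)
  ultimately have "card {(a, b). \<forall>w\<in>S. cubic a b w = 0} = card (PiE W ?L)"
    by (metis (no_types, lifting) card_image)
  also have "\<dots> = (\<Prod>w\<in>W. card (?L w))"
    by (simp add: card_PiE)
  also have "\<dots> = (\<Prod>w\<in>W - S. card (?L w)) * (\<Prod>w\<in>S. card (?L w))"
    using W by (intro prod.subset_diff) auto
  also have "(\<Prod>w\<in>W - S. card (?L w)) = (\<Prod>w\<in>W - S. P)"
    using W card_line by (intro prod.cong) auto
  also have "\<dots> = P ^ (4 - card S)"
    using W by (simp add: card_Diff_subset)
  finally show ?thesis
    by simp
qed

text \<open>Double counting of the pairs consisting of a cubic and a \<open>j\<close>-element set of its roots.\<close>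

lemma sum_binomial_card_roots:
  assumes V: "V \<subseteq> unit_circle" and j: "j \<le> 4"
  shows "(\<Sum>(a, b)\<in>UNIV. card {w\<in>V. cubic a b w = 0} choose j) = (card V choose j) * P ^ (4 - j)"
proof -
  let ?Sub = "{S. S \<subseteq> V \<and> card S = j}"
  have "(\<Sum>ab\<in>UNIV. card {w\<in>V. cubic (fst ab) (snd ab) w = 0} choose j)
      = (\<Sum>ab\<in>UNIV. card {S\<in>?Sub. \<forall>w\<in>S. cubic (fst ab) (snd ab) w = 0})"
  proof (intro sum.cong refl)
    fix ab :: "'a \<times> 'a"
    let ?R = "{w\<in>V. cubic (fst ab) (snd ab) w = 0}"
    have "{S\<in>?Sub. \<forall>w\<in>S. cubic (fst ab) (snd ab) w = 0} = {S. S \<subseteq> ?R \<and> card S = j}"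
      by auto
    then show "card ?R choose j = card {S\<in>?Sub. \<forall>w\<in>S. cubic (fst ab) (snd ab) w = 0}"
      by (simp add: n_subsets)
  qed
  also have "\<dots> = (\<Sum>S\<in>?Sub. card {ab\<in>UNIV. \<forall>w\<in>S. cubic (fst ab) (snd ab) w = 0})"
    by (rule sum_multicount_gen) auto
  also have "\<dots> = (\<Sum>S\<in>?Sub. P ^ (4 - j))"
  proof (intro sum.cong refl)
    fix S assume S: "S \<in> ?Sub"
    then have "S \<subseteq> unit_circle" "card S = j"
      using V by auto
    then show "card {ab\<in>UNIV. \<forall>w\<in>S. cubic (fst ab) (snd ab) w = 0} = P ^ (4 - j)"
      using card_cubics_vanishing[of S] j by (simp add: case_prod_beta')
  qed
  also have "\<dots> = (card V choose j) * P ^ (4 - j)"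
    by (simp add: n_subsets)
  finally show ?thesis
    by (simp add: case_prod_beta)
qed

end

section \<open>Additive characters and averaging over the subfield\<close>

lemma sum_additive_character_eq_0:
  fixes \<psi> :: "'a::ab_group_add \<Rightarrow> complex"
  assumes A: "\<And>x y. x \<in> A \<Longrightarrow> y \<in> A \<Longrightarrow> x + y \<in> A" "\<And>x y. x \<in> A \<Longrightarrow> y \<in> A \<Longrightarrow> x - y \<in> A"
    and hom: "\<And>x y. x \<in> A \<Longrightarrow> y \<in> A \<Longrightarrow> \<psi> (x + y) = \<psi> x * \<psi> y"
    and c: "c \<in> A" "\<psi> c \<noteq> 1"
  shows "sum \<psi> A = 0"
proof -
  \<comment> \<open>Translation by \<open>c\<close> permutes \<open>A\<close>, yet it multiplies the
    sum by \<open>\<psi> c\<close>, which is not 1.\<close>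
  have "sum \<psi> A = (\<Sum>x\<in>A. \<psi> (c + x))"
    by (rule sum.reindex_bij_witness[of _ "\<lambda>x. c + x" "\<lambda>x. x - c"])
      (use A c in \<open>auto simp: add.commute[of c]\<close>)
  also have "\<dots> = \<psi> c * sum \<psi> A"
    using hom c by (simp add: sum_distrib_left)
  finally show ?thesis
    using c by simp
qed

context quadratic_extension
begin

definition subfield :: "'a set" where
  "subfield = {y. conj y = y}"

lemma trace_in_subfield: "x + conj x \<in> subfield"
  by (simp add: subfield_def conj_add add.commute)

text \<open>Transitivity of the trace: the upper half of the Frobenius powers of \<open>x\<close> is
  the lower half for \<open>conj x\<close>.\<close>

lemma abs_trace_double: "abs_trace (2 * m) x = abs_trace m (x + conj x)"
proof -
  have "abs_trace (2 * m) x = (\<Sum>i<m. x ^ CHAR('a) ^ i) + (\<Sum>i=m..<m+m. x ^ CHAR('a) ^ i)"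
    unfolding abs_trace_def mult_2
    by (metis atLeast0LessThan le_add1 sum.atLeastLessThan_concat zero_le)
  also have "(\<Sum>i=m..<m+m. x ^ CHAR('a) ^ i) = (\<Sum>i<m. conj x ^ CHAR('a) ^ i)"
    using sum.shift_bounds_nat_ivl[of "\<lambda>i. x ^ CHAR('a) ^ i" 0 m m]
    by (simp add: conj_eq P_eq power_add atLeast0LessThan mult.commute flip: power_mult)
  finally show ?thesis
    by (simp add: abs_trace_add) (simp add: abs_trace_def)
qed

text \<open>Frobenius shifts the sum by one index, trading the term \<open>y\<close> for
  \<open>conj y\<close>, which equals \<open>y\<close> here.\<close>

lemma abs_trace_subfield_power_CHAR:
  assumes "y \<in> subfield"
  shows "abs_trace m y ^ CHAR('a) = abs_trace m y"
proof -
  have "abs_trace m y ^ CHAR('a) + y = (\<Sum>i<m. y ^ CHAR('a) ^ Suc i) + y"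
    by (simp add: abs_trace_def freshmans_dream_sum mult.commute flip: power_mult)
  also have "\<dots> = (\<Sum>i<Suc m. y ^ CHAR('a) ^ i)"
    by (subst sum.lessThan_Suc_shift) simp
  also have "\<dots> = abs_trace m y + conj y"
    by (simp add: abs_trace_def conj_eq P_eq)
  finally show ?thesis
    using assms by (simp add: subfield_def)
qed

text \<open>The canonical additive character of the field when \<open>z\<close> is a primitive root
  of unity of order \<open>CHAR('a)\<close>.\<close>

definition chi :: "complex \<Rightarrow> 'a \<Rightarrow> complex" where
  "chi z x = z ^ prime_field_rep (abs_trace (2 * m) x)"

lemma chi_eq_power:
  assumes "z ^ CHAR('a) = 1" "abs_trace (2 * m) x = of_nat k"
  shows "chi z x = z ^ k"
  using assms by (simp add: chi_def power_prime_field_rep_of_nat)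

lemma abs_trace_eq_of_nat:
  fixes x :: 'a
  obtains k where "k < CHAR('a)" "abs_trace (2 * m) x = of_nat k"
  by (rule prime_field_eq_range[OF abs_trace_subfield_power_CHAR[OF trace_in_subfield[of x]]])
    (use that abs_trace_double[of x] in auto)

lemma chi_add:
  assumes "z ^ CHAR('a) = 1"
  shows "chi z (x + y) = chi z x * chi z y"
proof -
  obtain i j where ij: "abs_trace (2 * m) x = of_nat i" "abs_trace (2 * m) y = of_nat j"
    by (metis abs_trace_eq_of_nat)
  then have "abs_trace (2 * m) (x + y) = of_nat (i + j)"
    by (simp add: abs_trace_add)
  then show ?thesis
    by (simp only: chi_eq_power[OF assms] ij power_add)
qed

lemma chi_neq_1:
  assumes "primitive_root_unity CHAR('a) z" "abs_trace (2 * m) x \<noteq> 0"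
  shows "chi z x \<noteq> 1"
proof -
  obtain k where k: "k < CHAR('a)" "abs_trace (2 * m) x = of_nat k"
    using abs_trace_eq_of_nat .
  with assms(2) have "k > 0"
    by (auto intro!: gr0I)
  with k assms(1) show ?thesis
    by (simp add: chi_eq_power primitive_root_unity_def)
qed

lemma chi_0:
  assumes "z ^ CHAR('a) = 1"
  shows "chi z 0 = 1"
  using chi_eq_power[OF assms, of 0 0] m_pos by simp

lemma conj_divide: "conj (x / y) = conj x / conj y"
  by (simp add: conj_eq power_divide)

lemma subfield_closed:
  "x \<in> subfield \<Longrightarrow> y \<in> subfield \<Longrightarrow> x + y \<in> subfield"
  "x \<in> subfield \<Longrightarrow> y \<in> subfield \<Longrightarrow> x - y \<in> subfield"
  "x \<in> subfield \<Longrightarrow> y \<in> subfield \<Longrightarrow> x * y \<in> subfield"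
  "x \<in> subfield \<Longrightarrow> y \<in> subfield \<Longrightarrow> x / y \<in> subfield"
  "0 \<in> subfield"
  by (simp_all add: subfield_def conj_add conj_minus conj_mult conj_divide)

end

context odd_quadratic_extension
begin

text \<open>The fixed field is the line at \<open>w = 1\<close>, so the count of cubics also yields
  its order.\<close>

lemma card_subfield: "card subfield = P"
proof -
  have "subfield = line 1"
    by (simp add: subfield_def line_def)
  then show ?thesis
    using card_line[of 1] by (simp add: unit_circle_def conj_eq)
qed

text \<open>Orthogonality: \<open>y \<mapsto> chi z (y * c)\<close> is a character of the subfield,
  trivial exactly when the relative trace of \<open>c\<close> is 0.\<close>

lemma sum_chi_subfield:
  assumes z: "primitive_root_unity CHAR('a) z"
  shows "(\<Sum>y\<in>subfield. chi z (y * c)) = (if c + conj c = 0 then of_nat P else 0)"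
proof -
  have z1: "z ^ CHAR('a) = 1"
    using z by (simp add: primitive_root_unity_def)
  have tr: "abs_trace (2 * m) (y * c) = abs_trace m (y * (c + conj c))" if "y \<in> subfield" for y
    unfolding abs_trace_double using that by (simp add: conj_mult subfield_def algebra_simps)
  show ?thesis
  proof (cases "c + conj c = 0")
    case True
    have "chi z (y * c) = 1" if "y \<in> subfield" for y
      using chi_eq_power[OF z1, of "y * c" 0] tr[OF that] True m_pos by simp
    with True show ?thesis
      by (simp add: card_subfield)
  next
    case False
    \<comment> \<open>The trace kernel is smaller than the subfield, so some \<open>v\<close> in the
      subfield has nonzero trace.\<close>
    have "CHAR('a) ^ (m - 1) < P"
      unfolding P_eq using m_pos prime_gt_1_nat[OF CHAR_prime[where 'a = 'a]]
      by (intro power_strict_increasing) auto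
    then have "card {x :: 'a. abs_trace m x = 0} < card subfield"
      using card_abs_trace_eq_0_le[OF m_pos, where 'a = 'a] card_subfield by simp
    then have "\<not> subfield \<subseteq> {x. abs_trace m x = 0}"
      using card_mono[of "{x. abs_trace m x = 0}" subfield] by auto
    then obtain v where v: "v \<in> subfield" "abs_trace m v \<noteq> 0"
      by auto
    \<comment> \<open>Dividing by the relative trace of \<open>c\<close> makes the absolute trace of
      \<open>?y * c\<close> equal to that of \<open>v\<close> from the subfield.\<close>
    let ?y = "v / (c + conj c)"
    have y: "?y \<in> subfield"
      by (intro subfield_closed(4) v(1) trace_in_subfield)
    have "abs_trace (2 * m) (?y * c) \<noteq> 0"
      using tr[OF y] False v by simp
    then have "chi z (?y * c) \<noteq> 1"
      by (rule chi_neq_1[OF z])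
    then have "(\<Sum>y\<in>subfield. chi z (y * c)) = 0"
      using y subfield_closed chi_add[OF z1]
      by (intro sum_additive_character_eq_0[where c = ?y]) (auto simp: distrib_right)
    with False show ?thesis
      by simp
  qed
qed

text \<open>Averaging over the dilations \<open>x \<mapsto> y * x\<close> by units \<open>y\<close> of the subfield replaces each summand
  by a complete character sum over the subfield.\<close>

lemma sum_chi_homogeneous:
  assumes z: "primitive_root_unity CHAR('a) z"
    and hom: "\<And>x y. y \<in> subfield \<Longrightarrow> y \<noteq> 0 \<Longrightarrow> F (y * x) = y * F x" and F0: "F 0 = 0"
    and card: "card {x. x \<noteq> 0 \<and> F x + conj (F x) = 0} = (P - 1) * N"
  shows "(\<Sum>x\<in>UNIV. chi z (F x)) = of_nat P * (of_nat N - 1)"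
proof -
  have z1: "z ^ CHAR('a) = 1"
    using z by (simp add: primitive_root_unity_def)
  let ?X = "UNIV - {0::'a}" and ?K = "subfield - {0}"
  let ?S = "\<Sum>x\<in>?X. chi z (F x)"
  have card_K: "card ?K = P - 1"
    by (simp add: card_subfield subfield_closed card_Diff_singleton)
  have card_X: "card ?X = (P + 1) * (P - 1)"
    using CARD_minus_1 by (simp add: card_Diff_singleton)
  have "of_nat (P - 1) * ?S = (\<Sum>y\<in>?K. \<Sum>x\<in>?X. chi z (F x))"
    by (simp only: sum_constant card_K)
  also have "\<dots> = (\<Sum>y\<in>?K. \<Sum>x\<in>?X. chi z (y * F x))"
  proof (rule sum.cong[OF refl])
    fix y assume y: "y \<in> ?K"
    have "(\<Sum>x\<in>?X. chi z (F x)) = (\<Sum>x\<in>?X. chi z (F (y * x)))"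
      by (rule sum.reindex_bij_witness[of _ "\<lambda>x. y * x" "\<lambda>x. x / y"]) (use y in auto)
    then show "(\<Sum>x\<in>?X. chi z (F x)) = (\<Sum>x\<in>?X. chi z (y * F x))"
      using hom y by simp
  qed
  also have "\<dots> = (\<Sum>x\<in>?X. \<Sum>y\<in>?K. chi z (y * F x))"
    by (rule sum.swap)
  \<comment> \<open>Leaving out \<open>y = 0\<close> subtracts \<open>chi z 0 = 1\<close> from each
    complete sum.\<close>
  also have "\<dots> = (\<Sum>x\<in>?X. (if F x + conj (F x) = 0 then of_nat P else 0) - 1)"
    using sum_chi_subfield[OF z] subfield_closed by (simp add: sum_diff1 chi_0[OF z1])
  also have "\<dots> = of_nat P * of_nat (card {x\<in>?X. F x + conj (F x) = 0}) - of_nat (card ?X)"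
    by (simp add: sum_subtractf sum.If_cases Int_def del: card_Diff_insert)
  also have "{x\<in>?X. F x + conj (F x) = 0} = {x. x \<noteq> 0 \<and> F x + conj (F x) = 0}"
    by auto
  also have "of_nat P * of_nat (card \<dots>) - of_nat (card ?X)
      = (of_nat (P - 1) * (of_nat P * of_nat N - of_nat (P + 1)) :: complex)"
    unfolding card card_X of_nat_mult by (simp only: right_diff_distrib mult_ac)
  finally have "?S = of_nat P * of_nat N - of_nat (P + 1)"
    using P_gt_1 by (simp del: of_nat_add of_nat_diff)
  \<comment> \<open>The summand at \<open>x = 0\<close> is 1 and turns \<open>- (P + 1)\<close> into
    \<open>- P\<close>.\<close>
  moreover have "(\<Sum>x\<in>UNIV. chi z (F x)) = ?S + chi z (F 0)"
    by (simp add: sum_diff1)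
  ultimately show ?thesis
    by (simp add: F0 chi_0[OF z1] algebra_simps)
qed

section \<open>From the exponential sum to the number of roots\<close>

lemma niho_homogeneous:
  assumes "y \<in> subfield" "y \<noteq> 0"
  shows "(y * x) ^ (s * (P - 1) + 1) = y * x ^ (s * (P - 1) + 1)"
proof -
  \<comment> \<open>Units of the subfield satisfy \<open>y ^ (P - 1) = 1\<close>, so an exponent
    congruent to 1 modulo \<open>P - 1\<close> fixes them.\<close>
  have "y * y ^ (P - 1) = y ^ Suc (P - 1)"
    by (simp only: power_Suc)
  also have "\<dots> = y"
    using assms P_gt_1 by (simp add: subfield_def conj_eq)
  finally have "y ^ (P - 1) = 1"
    using assms by simp
  then have "y ^ (s * (P - 1)) = 1"
    by (metis mult.commute power_mult power_one)
  then show ?thesis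
    by (simp add: power_mult_distrib)
qed

lemma power_in_unit_circle_iff: "x ^ (P - 1) \<in> unit_circle \<longleftrightarrow> x \<noteq> 0"
proof (cases "x = 0")
  case True
  then show ?thesis
    using P_gt_1 by (simp add: unit_circle_def power_0_left)
next
  case False
  have "(x ^ (P - 1)) ^ (P + 1) = x ^ ((P + 1) * (P - 1))"
    by (metis mult.commute power_mult)
  also have "\<dots> = 1"
    by (rule power_cofactor[OF CARD_minus_1 False])
  finally show ?thesis
    unfolding unit_circle_eq mem_Collect_eq using False by blast
qed

text \<open>With \<open>u = x ^ (P - 1)\<close> one has \<open>conj x = u * x\<close>, and
  \<open>conj u\<close> is the inverse of \<open>u\<close>. The factor
  \<open>u ^ (3 * j + 1)\<close> clears all negative powers of \<open>u\<close> from the trace and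
  leaves \<open>x\<close> times the cubic.\<close>

lemma trace_eq_0_iff_cubic:
  assumes "x \<noteq> 0"
    and F_def: "F = a * x ^ ((j + 1) * (P - 1) + 1) + b * x ^ ((3 * j + 2) * (P - 1) + 1)"
  shows "F + conj F = 0 \<longleftrightarrow> cubic a b ((x ^ (P - 1)) ^ (2 * j + 1)) = 0"
proof -
  define u where "u = x ^ (P - 1)"
  have exponent: "x ^ (s * (P - 1) + 1) = u ^ s * x" for s
    by (simp add: u_def mult.commute flip: power_mult)
  have conj_x: "conj x = u * x"
    using P_gt_1 by (simp add: conj_eq u_def flip: power_Suc2)
  have u: "u * conj u = 1"
    using assms(1) power_in_unit_circle_iff[of x] by (simp add: u_def unit_circle_def mult.commute)
  then have inv: "u ^ k * conj u ^ k = 1" for k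
    by (simp flip: power_mult_distrib)
  have "u ^ (3 * j + 1) * (F + conj F)
     = x * (a * (u ^ (3 * j + 1) * u ^ (j + 1)) + b * (u ^ (3 * j + 1) * u ^ (3 * j + 2))
         + conj a * ((u ^ (j + 1) * conj u ^ (j + 1)) * u ^ (2 * j + 1))
         + conj b * (u ^ (3 * j + 2) * conj u ^ (3 * j + 2)))"
    unfolding F_def exponent conj_add conj_mult conj_power conj_x
    by (simp add: algebra_simps power_add power2_eq_square power_mult power3_eq_cube)
  also have "\<dots> = x * cubic a b (u ^ (2 * j + 1))"
  proof -
    have "3 * j + 1 + (j + 1) = (2 * j + 1) * 2" "3 * j + 1 + (3 * j + 2) = (2 * j + 1) * 3"
      by simp_all
    then have "u ^ (3 * j + 1) * u ^ (j + 1) = (u ^ (2 * j + 1)) ^ 2"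
        "u ^ (3 * j + 1) * u ^ (3 * j + 2) = (u ^ (2 * j + 1)) ^ 3"
      by (metis power_add power_mult)+
    then show ?thesis
      unfolding inv cubic_def by (simp only: mult_1_left mult_1_right add_ac)
  qed
  finally have "u ^ (3 * j + 1) * (F + conj F) = x * cubic a b (u ^ (2 * j + 1))" .
  moreover have "u ^ (3 * j + 1) \<noteq> 0"
    using assms(1) by (simp add: u_def)
  ultimately show ?thesis
    using assms(1) by (metis mult_eq_0_iff u_def)
qed

lemma unit_circle_mult: "x \<in> unit_circle \<Longrightarrow> y \<in> unit_circle \<Longrightarrow> x * y \<in> unit_circle"
  by (simp add: unit_circle_eq power_mult_distrib del: power_Suc add_Suc_right)

lemma unit_circle_divide: "x \<in> unit_circle \<Longrightarrow> y \<in> unit_circle \<Longrightarrow> x / y \<in> unit_circle"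
  by (simp add: unit_circle_eq power_divide del: power_Suc add_Suc_right)

text \<open>A nonempty fibre is a coset of the kernel. The kernel is the group of
  \<open>g\<close>-th roots of unity, of full size because \<open>g\<close> divides the order of the
  unit group.\<close>

lemma card_power_fibre_unit_circle:
  assumes "w \<in> (\<lambda>z. z ^ k) ` unit_circle"
  shows "card {z \<in> unit_circle. z ^ k = w} = gcd k (P + 1)"
proof -
  define g where "g = gcd k (P + 1)"
  obtain z0 where z0: "z0 \<in> unit_circle" "w = z0 ^ k"
    using assms by auto
  have z0_nz: "z0 \<noteq> 0"
    using z0 by (auto simp: unit_circle_def)
  have gcd_iff: "u ^ g = 1 \<longleftrightarrow> u ^ k = 1 \<and> u \<in> unit_circle" for u :: 'a
  proof
    assume "u ^ g = 1"
    moreover have "g dvd k" "g dvd P + 1"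
      by (simp_all add: g_def)
    ultimately show "u ^ k = 1 \<and> u \<in> unit_circle"
      unfolding unit_circle_eq mem_Collect_eq by (metis dvdE power_mult power_one)
  next
    assume u: "u ^ k = 1 \<and> u \<in> unit_circle"
    \<comment> \<open>Bezout in subtraction-free form, so that it can be read off in
      exponents.\<close>
    obtain x y where "(P + 1) * x = k * y + g"
      using bezout_nat[of "P + 1" k] by (auto simp: gcd.commute g_def)
    then have "(u ^ (P + 1)) ^ x = (u ^ k) ^ y * u ^ g"
      by (metis power_add power_mult)
    with u show "u ^ g = 1"
      unfolding unit_circle_eq mem_Collect_eq by simp
  qed
  have "g dvd CARD('a) - 1"
    unfolding CARD_minus_1 g_def by (rule dvd_mult2) simp
  then obtain K where "CARD('a) - 1 = g * K"
    by auto
  then have card: "card {u :: 'a. u ^ g = 1} = g"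
    by (rule card_roots_of_unity_and_fibre)
  have "bij_betw (\<lambda>u. z0 * u) {u. u ^ g = 1} {z \<in> unit_circle. z ^ k = w}"
    by (rule bij_betwI[where g = "\<lambda>z. z / z0"])
      (use z0 z0_nz in \<open>auto simp: gcd_iff unit_circle_mult unit_circle_divide
        power_mult_distrib power_divide\<close>)
  from bij_betw_same_card[OF this] card have "card {z \<in> unit_circle. z ^ k = w} = g"
    by (rule trans[OF sym])
  then show ?thesis
    by (simp only: g_def)
qed

lemma card_power_image_unit_circle:
  "gcd k (P + 1) * card ((\<lambda>z. z ^ k) ` unit_circle) = P + 1"
proof -
  have "card {z \<in> unit_circle. z ^ k \<in> (\<lambda>z. z ^ k) ` unit_circle}
      = gcd k (P + 1) * card ((\<lambda>z. z ^ k) ` unit_circle)"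
    using card_power_fibre_unit_circle by (intro card_preimage_const) auto
  moreover have "{z \<in> unit_circle. z ^ k \<in> (\<lambda>z. z ^ k) ` unit_circle} = unit_circle"
    by auto
  ultimately show ?thesis
    by (simp only: card_unit_circle)
qed

definition root_set :: "nat \<Rightarrow> 'a \<Rightarrow> 'a \<Rightarrow> 'a set" where
  "root_set k a b = {w \<in> (\<lambda>z. z ^ k) ` unit_circle. cubic a b w = 0}"

text \<open>The units of relative trace 0 are counted through two maps with constant fibre size:
  \<open>x \<mapsto> x ^ (P - 1)\<close>, then \<open>u \<mapsto> u ^ (2 * j + 1)\<close> on the
  unit circle.\<close>

lemma exp_sum_eq:
  assumes z: "primitive_root_unity CHAR('a) z"
  shows "exp_sum z (2 * m) ((j + 1) * (P - 1) + 1) ((3 * j + 2) * (P - 1) + 1) a b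
     = of_nat P * (of_nat (gcd (2 * j + 1) (P + 1) * card (root_set (2 * j + 1) a b)) - 1)"
proof -
  let ?k = "2 * j + 1"
  let ?F = "\<lambda>x. a * x ^ ((j + 1) * (P - 1) + 1) + b * x ^ ((3 * j + 2) * (P - 1) + 1)"
  let ?Z = "{u \<in> unit_circle. cubic a b (u ^ ?k) = 0}"
  have fibre: "card {x\<in>UNIV. x ^ (P - 1) = u} = P - 1" if "u \<in> ?Z" for u
    using card_roots_of_unity_and_fibre(2)[OF CARD_minus_1, of u] that by (simp add: unit_circle_eq)
  have "{x. x \<noteq> 0 \<and> ?F x + conj (?F x) = 0} = {x\<in>UNIV. x ^ (P - 1) \<in> ?Z}"
    using power_in_unit_circle_iff trace_eq_0_iff_cubic[OF _ refl, of _ a j b] by auto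
  also have "card \<dots> = (P - 1) * card ?Z"
    by (rule card_preimage_const) (use fibre in auto)
  also have "?Z = {u \<in> unit_circle. u ^ ?k \<in> root_set ?k a b}"
    unfolding root_set_def by blast
  also have "card \<dots> = gcd ?k (P + 1) * card (root_set ?k a b)"
  proof (rule card_preimage_const)
    fix w assume "w \<in> root_set ?k a b"
    then show "card {u \<in> unit_circle. u ^ ?k = w} = gcd ?k (P + 1)"
      unfolding root_set_def by (intro card_power_fibre_unit_circle) blast
  qed simp_all
  finally have card: "card {x. x \<noteq> 0 \<and> ?F x + conj (?F x) = 0}
      = (P - 1) * (gcd ?k (P + 1) * card (root_set ?k a b))" .
  have "exp_sum z (2 * m) ((j + 1) * (P - 1) + 1) ((3 * j + 2) * (P - 1) + 1) a b
      = (\<Sum>x\<in>UNIV. chi z (?F x))"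
    by (simp add: exp_sum_def chi_def)
  also have "\<dots> = of_nat P * (of_nat (gcd ?k (P + 1) * card (root_set ?k a b)) - 1)"
  proof (rule sum_chi_homogeneous[OF z _ _ card])
    show "?F (y * x) = y * ?F x" if "y \<in> subfield" "y \<noteq> 0" for x y
      unfolding niho_homogeneous[OF that] by (simp only: distrib_left mult.left_commute)
  qed simp
  finally show ?thesis .
qed

end

section \<open>The distribution of the number of roots\<close>

lemma real_choose_2: "real (n choose 2) = real n * (real n - 1) / 2"
  by (simp add: binomial_gbinomial gbinomial_prod_rev eval_nat_numeral)

lemma real_choose_3: "real (n choose 3) = real n * (real n - 1) * (real n - 2) / 6"
  by (simp add: binomial_gbinomial gbinomial_prod_rev eval_nat_numeral)

context odd_quadratic_extension
begin

lemma card_root_set_le: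
  assumes "(a, b) \<noteq> (0, 0)"
  shows "card (root_set k a b) \<le> 3"
proof -
  have "card (root_set k a b) \<le> card {w. cubic a b w = 0}"
    by (rule card_mono) (auto simp: root_set_def)
  with card_cubic_roots_le[OF assms] show ?thesis
    by simp
qed

lemma card_root_set_0: "card (root_set k 0 0) = card ((\<lambda>z. z ^ k) ` unit_circle)"
  by (simp add: root_set_def cubic_def)

text \<open>The double count runs over all pairs. The zero pair has all \<open>M\<close> points as
  roots and is split off; every other pair has at most three.\<close>

lemma card_root_set_moment:
  assumes M: "M = card ((\<lambda>z. z ^ k) ` unit_circle)" "M > 3" and j: "j \<le> 3"
  shows "(M choose j) + (\<Sum>i\<le>3. card {(a, b). card (root_set k a b) = i} * (i choose j))
    = (M choose j) * P ^ (4 - j)"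
proof -
  let ?r = "\<lambda>ab. card (root_set k (fst ab) (snd ab))"
  let ?A = "UNIV - {(0::'a, 0::'a)}"
  have r0: "?r (0, 0) = M"
    by (simp add: card_root_set_0 M)
  have le: "?r ab \<le> 3" if "ab \<in> ?A" for ab
    using that card_root_set_le[of "fst ab" "snd ab"] by (cases ab) auto
  have "(\<lambda>z. z ^ k) ` unit_circle \<subseteq> unit_circle"
    using unit_circle_power by auto
  then have "(M choose j) * P ^ (4 - j) = (\<Sum>ab\<in>UNIV. ?r ab choose j)"
    using sum_binomial_card_roots[of "(\<lambda>z. z ^ k) ` unit_circle" j] j M
    by (simp add: root_set_def case_prod_beta')
  also have "\<dots> = (M choose j) + (\<Sum>ab\<in>?A. ?r ab choose j)"
    using r0 by (subst sum.remove[of _ "(0, 0)"]) simp_all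
  also have "(\<Sum>ab\<in>?A. ?r ab choose j) = (\<Sum>i\<le>3. \<Sum>ab\<in>{ab\<in>?A. ?r ab = i}. ?r ab choose j)"
    using le by (intro sum.group[symmetric]) auto
  also have "\<dots> = (\<Sum>i\<le>3. card {(a, b). card (root_set k a b) = i} * (i choose j))"
  proof (rule sum.cong[OF refl])
    fix i :: nat assume i: "i \<in> {..3}"
    \<comment> \<open>As \<open>M > 3\<close>, the zero pair lies in none of the classes
      \<open>i \<le> 3\<close>.\<close>
    have "{ab\<in>?A. ?r ab = i} = {(a, b). card (root_set k a b) = i}"
      using i M(2) r0 by auto
    moreover have "(\<Sum>ab\<in>{ab\<in>?A. ?r ab = i}. ?r ab choose j)
        = (\<Sum>ab\<in>{ab\<in>?A. ?r ab = i}. i choose j)"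
      by (rule sum.cong) simp_all
    ultimately show "(\<Sum>ab\<in>{ab\<in>?A. ?r ab = i}. ?r ab choose j)
        = card {(a, b). card (root_set k a b) = i} * (i choose j)"
      by (simp only: sum_constant of_nat_id)
  qed
  finally show ?thesis
    by simp
qed

text \<open>Since \<open>i choose j = 0\<close> for \<open>i < j\<close>, the moments form a
  triangular system, solved from \<open>c 3\<close> downwards.\<close>

lemma card_root_set_distribution:
  assumes M: "M = card ((\<lambda>z. z ^ k) ` unit_circle)" "M > 3"
  defines "c \<equiv> \<lambda>i. real (card {(a, b). card (root_set k a b) = i})"
    and "p \<equiv> real P" and "\<mu> \<equiv> real M"
  shows "c 3 = \<mu> * (\<mu> - 1) * (\<mu> - 2) / 6 * (p - 1)"
    and "c 2 = \<mu> * (\<mu> - 1) / 2 * (p ^ 2 - 1) - 3 * c 3"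
    and "c 1 = \<mu> * (p ^ 3 - 1) - 2 * c 2 - 3 * c 3"
    and "c 0 = p ^ 4 - 1 - c 1 - c 2 - c 3"
proof -
  have moment: "real (M choose j) + (\<Sum>i\<le>3. c i * real (i choose j)) = real (M choose j) * p ^ (4 - j)"
    if "j \<le> 3" for j
    using arg_cong[OF card_root_set_moment[OF M that], of real] by (simp add: c_def p_def)
  have "real (M choose 3) + c 3 = real (M choose 3) * p"
    using moment[of 3] by (simp add: numeral_eq_Suc)
  then have "c 3 = real (M choose 3) * (p - 1)"
    by (simp add: algebra_simps)
  then show "c 3 = \<mu> * (\<mu> - 1) * (\<mu> - 2) / 6 * (p - 1)"
    by (simp only: real_choose_3 \<mu>_def)
  have "real (M choose 2) + (c 2 + 3 * c 3) = real (M choose 2) * p ^ 2"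
    using moment[of 2] by (simp add: numeral_eq_Suc)
  then have "c 2 = real (M choose 2) * (p ^ 2 - 1) - 3 * c 3"
    by (simp add: algebra_simps)
  then show "c 2 = \<mu> * (\<mu> - 1) / 2 * (p ^ 2 - 1) - 3 * c 3"
    by (simp only: real_choose_2 \<mu>_def)
  show "c 1 = \<mu> * (p ^ 3 - 1) - 2 * c 2 - 3 * c 3"
    using moment[of 1] by (simp add: numeral_eq_Suc \<mu>_def algebra_simps)
  show "c 0 = p ^ 4 - 1 - c 1 - c 2 - c 3"
    using moment[of 0] by (simp add: numeral_eq_Suc algebra_simps)
qed

end

section \<open>Arithmetic of the parameters and closed formulas\<close>

lemma gcd_double_odd:
  fixes k N :: nat
  assumes "odd k" "even N"
  shows "gcd (2 * k) N = 2 * gcd k N"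
proof -
  obtain h where h: "N = 2 * h"
    using assms by auto
  have "coprime k 2"
    using assms by simp
  then show ?thesis
    by (simp add: h gcd_mult_distrib_nat gcd_mult_right_left_cancel)
qed

lemma CHAR_eq_of_CARD_eq_prime_power:
  assumes "prime p" "CARD('a::finite_field) = p ^ n"
  shows "CHAR('a) = p"
proof -
  have "CHAR('a) dvd p ^ n"
    using CHAR_dvd_CARD[where 'a = 'a] assms by simp
  then have "CHAR('a) dvd p"
    by (rule prime_dvd_power[OF CHAR_prime])
  with assms show ?thesis
    by (simp add: primes_dvd_imp_eq)
qed

text \<open>Once \<open>P\<close> and \<open>L\<close> are written in \<open>g\<close> and
  \<open>\<mu>\<close> and denominators are cleared, each claim is a polynomial identity.\<close>

lemma distribution_closed_form:
  fixes g \<mu> P L c0 c1 c2 c3 :: real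
  assumes "g \<noteq> 0" and P: "P = g * \<mu> - 1" and L: "L = 2 * g"
    and c: "c3 = \<mu> * (\<mu> - 1) * (\<mu> - 2) / 6 * (P - 1)"
      "c2 = \<mu> * (\<mu> - 1) / 2 * (P ^ 2 - 1) - 3 * c3"
      "c1 = \<mu> * (P ^ 3 - 1) - 2 * c2 - 3 * c3"
      "c0 = P ^ 4 - 1 - c1 - c2 - c3"
  shows "c3 = 2 * (P ^ 2 - 1) * (L - P - 1) * (L - 2 * P - 2) / (3 * L ^ 3)"
    and "c2 = (P ^ 2 - 1) * (2 * P + 2 - (P + 3) * L) * (L - 2 * P - 2) / L ^ 3"
    and "c1 = 2 * (P ^ 2 - 1) * ((P ^ 2 + 2 * P + 3) * L ^ 2 - (2 * P ^ 2 + 7 * P + 5) * L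
          + 2 * (P + 1) ^ 2) / L ^ 3"
    and "c0 = (P ^ 2 - 1) * (3 * (P ^ 2 + 1) * L ^ 3 - (6 * P ^ 2 + 9 * P + 11) * L ^ 2
          + 6 * (P ^ 2 + 3 * P + 2) * L - 4 * (P + 1) ^ 2) / (3 * L ^ 3)"
proof -
  have L0: "L ^ 3 \<noteq> 0" "3 * L ^ 3 \<noteq> 0"
    using assms by simp_all
  show "c3 = 2 * (P ^ 2 - 1) * (L - P - 1) * (L - 2 * P - 2) / (3 * L ^ 3)"
    unfolding nonzero_eq_divide_eq[OF L0(1)] nonzero_eq_divide_eq[OF L0(2)]
    by (simp add: c P L field_simps eval_nat_numeral)
  show "c2 = (P ^ 2 - 1) * (2 * P + 2 - (P + 3) * L) * (L - 2 * P - 2) / L ^ 3"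
    unfolding nonzero_eq_divide_eq[OF L0(1)] nonzero_eq_divide_eq[OF L0(2)]
    by (simp add: c P L field_simps eval_nat_numeral)
  show "c1 = 2 * (P ^ 2 - 1) * ((P ^ 2 + 2 * P + 3) * L ^ 2 - (2 * P ^ 2 + 7 * P + 5) * L
          + 2 * (P + 1) ^ 2) / L ^ 3"
    unfolding nonzero_eq_divide_eq[OF L0(1)] nonzero_eq_divide_eq[OF L0(2)]
    by (simp add: c P L field_simps eval_nat_numeral)
  show "c0 = (P ^ 2 - 1) * (3 * (P ^ 2 + 1) * L ^ 3 - (6 * P ^ 2 + 9 * P + 11) * L ^ 2
          + 6 * (P ^ 2 + 3 * P + 2) * L - 4 * (P + 1) ^ 2) / (3 * L ^ 3)"
    unfolding nonzero_eq_divide_eq[OF L0(1)] nonzero_eq_divide_eq[OF L0(2)]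
    by (simp add: c P L field_simps eval_nat_numeral)
qed
theorem theorem17:
  fixes m n p q t s1 s2 d1 d2 l :: nat
    and \<zeta> :: complex
    and T2 :: "'a::finite_field \<Rightarrow> 'a \<Rightarrow> complex"
    and P L :: real
  assumes "m \<ge> 1" and "n = 2 * m"
    and "prime p" and "odd p" and "q = p ^ n"
    and "CARD('a) = q"
    and "primitive_root_unity p \<zeta>"
    and "t > 0" and "t mod 4 = 2" and "\<not> (p ^ m + 1) dvd t"
    and "s1 = (t + 2) div 4" and "s2 = (3 * t + 2) div 4"
    and "d1 = s1 * (p ^ m - 1) + 1" and "d2 = s2 * (p ^ m - 1) + 1"
    and "l = gcd t (p ^ m + 1)"
    and "T2 = exp_sum \<zeta> n d1 d2"
    and "P = real p ^ m" and "L = real l"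
  shows "range (\<lambda>(a, b). T2 a b) \<subseteq>
           complex_of_real ` {P ^ 2, (3 * L / 2 - 1) * P, (L - 1) * P, (L / 2 - 1) * P, - P}
    \<and> card {(a, b). T2 a b = complex_of_real (P ^ 2)} = 1
    \<and> real (card {(a, b). T2 a b = complex_of_real ((3 * L / 2 - 1) * P)}) =
        2 * (P ^ 2 - 1) * (L - P - 1) * (L - 2 * P - 2) / (3 * L ^ 3)
    \<and> real (card {(a, b). T2 a b = complex_of_real ((L - 1) * P)}) =
        (P ^ 2 - 1) * (2 * P + 2 - (P + 3) * L) * (L - 2 * P - 2) / L ^ 3
    \<and> real (card {(a, b). T2 a b = complex_of_real ((L / 2 - 1) * P)}) =
        2 * (P ^ 2 - 1) * ((P ^ 2 + 2 * P + 3) * L ^ 2 - (2 * P ^ 2 + 7 * P + 5) * L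
          + 2 * (P + 1) ^ 2) / L ^ 3
    \<and> real (card {(a, b). T2 a b = complex_of_real (- P)}) =
        (P ^ 2 - 1) * (3 * (P ^ 2 + 1) * L ^ 3 - (6 * P ^ 2 + 9 * P + 11) * L ^ 2
          + 6 * (P ^ 2 + 3 * P + 2) * L - 4 * (P + 1) ^ 2) / (3 * L ^ 3)"
proof -
  have char: "CHAR('a) = p"
    using CHAR_eq_of_CARD_eq_prime_power assms by blast
  interpret odd_quadratic_extension m "p ^ m" "\<lambda>x::'a. x ^ p ^ m"
    by standard (use assms char in \<open>simp_all add: mult.commute flip: power_mult\<close>)

  define j where "j = t div 4"
  define k where "k = 2 * j + 1"
  define g where "g = gcd k (p ^ m + 1)"
  define M where "M = card ((\<lambda>z. z ^ k) ` unit_circle)"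
  define r where "r = (\<lambda>a b. card (root_set k a b))"
  \<comment> \<open>Hence \<open>t\<close> is twice the odd number \<open>k\<close>, and
    \<open>s1\<close>, \<open>s2\<close> are exact quotients.\<close>
  have t: "t = 4 * j + 2"
    using assms(9) unfolding j_def by presburger
  have s: "s1 = j + 1" "s2 = 3 * j + 2"
    using assms(11,12) t by simp_all
  have t2: "t = 2 * k"
    by (simp add: t k_def)
  have "odd k" "even (p ^ m + 1)"
    using odd_P by (simp_all add: k_def)
  then have l: "l = 2 * g"
    unfolding assms(15) g_def t2 by (rule gcd_double_odd)
  have gM: "g * M = p ^ m + 1"
    unfolding g_def M_def by (rule card_power_image_unit_circle)
  have g_pos: "g > 0"
    by (simp add: g_def)
  have "odd g"
    using \<open>odd k\<close> unfolding g_def by (metis dvd_trans gcd_dvd1)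
  then have "even M"
    using gM \<open>even (p ^ m + 1)\<close> by (metis even_mult_iff)
  \<comment> \<open>\<open>M = 2\<close> would make \<open>l = p ^ m + 1\<close> divide
    \<open>t\<close>. Being even and nonzero, \<open>M\<close> is then at least 4.\<close>
  moreover have "M \<noteq> 2"
  proof
    assume "M = 2"
    with gM l have "l = p ^ m + 1"
      by simp
    moreover have "l dvd t"
      using assms(15) by simp
    ultimately show False
      using assms(10) by simp
  qed
  moreover have "M \<noteq> 0"
    using gM by (intro notI) simp
  ultimately have M: "M > 3"
    by presburger

  have P: "P = real g * real M - 1"
    using assms(17) arg_cong[OF gM, of real] by simp
  have P_pos: "P > 0"
    using assms(17) prime_gt_0_nat[OF assms(3)] by simp
  have L: "L = 2 * real g"
    by (simp add: assms(18) l)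

  have T2: "T2 a b = complex_of_real ((real g * real (r a b) - 1) * P)" for a b
    using exp_sum_eq[of \<zeta> j a b] assms(7)
    unfolding assms(2,13,14,16) s char
    by (simp add: assms(17) g_def k_def r_def mult.commute)
  \<comment> \<open>\<open>g\<close> and \<open>P\<close> are positive, so distinct root counts give
    distinct values.\<close>
  have T2_eq_iff: "T2 a b = complex_of_real ((real g * real i - 1) * P) \<longleftrightarrow> r a b = i" for a b i
    using P_pos g_pos unfolding T2 of_real_eq_iff by simp
  \<comment> \<open>The value at the zero pair is the case \<open>i = M\<close> of the common
    formula.\<close>
  have P2: "P ^ 2 = (real g * real M - 1) * P"
    by (simp add: P power2_eq_square)
  \<comment> \<open>The root counts are kept as \<open>real 3\<close>, ..., \<open>real 0\<close> so
    that \<open>T2_eq_iff\<close> applies to each value.\<close>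
  have value_eqs:
    "(3 * L / 2 - 1) * P = (real g * real 3 - 1) * P"
    "(L - 1) * P = (real g * real 2 - 1) * P"
    "(L / 2 - 1) * P = (real g * real 1 - 1) * P"
    "- P = (real g * real 0 - 1) * P"
    by (simp_all add: L)
  have r_le: "r a b \<le> 3" if "(a, b) \<noteq> (0, 0)" for a b
    using card_root_set_le[OF that] by (simp add: r_def)
  have r_0: "r 0 0 = M"
    by (simp add: r_def M_def card_root_set_0)
  have r_cases: "r a b \<in> {M, 3, 2, 1, 0}" for a b
    using r_le[of a b] r_0 by (cases "(a, b) = (0, 0)") auto
  have "range (\<lambda>(a, b). T2 a b) \<subseteq>
      complex_of_real ` {P ^ 2, (3 * L / 2 - 1) * P, (L - 1) * P, (L / 2 - 1) * P, - P}"
  proof clarify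
    fix a b
    have "T2 a b \<in> complex_of_real ` (\<lambda>i. (real g * real i - 1) * P) ` {M, 3, 2, 1, 0}"
      unfolding T2 by (intro imageI r_cases)
    then show "T2 a b \<in> complex_of_real ` {P ^ 2, (3 * L / 2 - 1) * P, (L - 1) * P, (L / 2 - 1) * P, - P}"
      by (simp only: P2 value_eqs image_insert image_empty)
  qed
  moreover have "r a b = M \<longleftrightarrow> (a, b) = (0, 0)" for a b
    using r_le[of a b] r_0 M by (cases "(a, b) = (0, 0)") auto
  then have "{(a, b). r a b = M} = {(0, 0)}"
    by auto
  then have "card {(a, b). T2 a b = complex_of_real (P ^ 2)} = 1"
    unfolding P2 T2_eq_iff by simp
  moreover
  define c where "c = (\<lambda>i. real (card {(a, b). r a b = i}))"
  have P': "P = real (p ^ m)"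
    using assms(17) by simp
  have "c 3 = real M * (real M - 1) * (real M - 2) / 6 * (P - 1)"
      and "c 2 = real M * (real M - 1) / 2 * (P ^ 2 - 1) - 3 * c 3"
      and "c 1 = real M * (P ^ 3 - 1) - 2 * c 2 - 3 * c 3"
      and "c 0 = P ^ 4 - 1 - c 1 - c 2 - c 3"
    unfolding c_def r_def P' by (rule card_root_set_distribution[OF M_def M])+
  note distribution = this
  have "real g \<noteq> 0"
    using g_pos by simp
  note closed_form = distribution_closed_form[OF this P L distribution]
  ultimately show ?thesis
    unfolding value_eqs T2_eq_iff c_def by blast
qed

end
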